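(* Let $H$ be a complex Hilbert space and let $A,B\in B(H)$ be such that $AB=BA$. If $A$ is normal and $A^*B+B^*A\leq 0$, then $|A+B|\leq |A|+|B|$.
   Context: $B(H)$ denotes the algebra of bounded linear operators on $H$. An operator $T\in B(H)$ is positive, $T\geq 0$, if $\langle Tx,x\rangle\geq 0$ for all $x\in H$; for self-adjoint $S,T$, $S\leq T$ means $T-S\geq 0$. For $T\in B(H)$, $|T|=\sqrt{T^*T}$ denotes the absolute value (modulus) of $T$, i.e. the unique positive square root of $T^*T$. An operator $T$ is normal if $TT^*=T^*T$. *)

theory Defs
  imports "HOL-Analysis.Analysis"
begin

text \<open>
  A complex inner product space is presented as a real inner product space (which supplies norm,
  metric and topology) with a complex scalar multiplication extending the real one and a
  sesquilinear form whose real part is the real inner product. The form is linear in the first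
  argument. Positive definiteness is inherited from the real inner product, see
  \<open>cinner_same\<close>.
\<close>

class complex_inner = real_inner +
  fixes scaleC :: "complex \<Rightarrow> 'a \<Rightarrow> 'a"  (infixr "*\<^sub>C" 75)
    and cinner :: "'a \<Rightarrow> 'a \<Rightarrow> complex"
  assumes scaleC_add_right: "c *\<^sub>C (x + y) = c *\<^sub>C x + c *\<^sub>C y"
    and scaleC_add_left: "(c + d) *\<^sub>C x = c *\<^sub>C x + d *\<^sub>C x"
    and scaleC_scaleC: "c *\<^sub>C d *\<^sub>C x = (c * d) *\<^sub>C x"
    and scaleC_of_real: "complex_of_real r *\<^sub>C x = r *\<^sub>R x"
    and cinner_add_left: "cinner (x + y) z = cinner x z + cinner y z"
    and cinner_scaleC_left: "cinner (c *\<^sub>C x) y = c * cinner x y"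
    and cinner_commute: "cinner x y = cnj (cinner y x)"
    and Re_cinner: "Re (cinner x y) = inner x y"

class complex_hilbert_space = complex_inner + complete_space

lemma cinner_same: "cinner x x = complex_of_real ((norm x)\<^sup>2)"
proof (rule complex_eqI)
  show "Re (cinner x x) = Re (complex_of_real ((norm x)\<^sup>2))"
    by (simp add: Re_cinner power2_norm_eq_inner)
  have "Im (cinner x x) = - Im (cinner x x)"
    by (metis cinner_commute cnj.simps(2))
  then show "Im (cinner x x) = Im (complex_of_real ((norm x)\<^sup>2))"
    by simp
qed

lemma cinner_add_right: "cinner x (y + z) = cinner x y + cinner x z"
  by (metis cinner_add_left cinner_commute complex_cnj_add)

lemma cinner_scaleC_right: "cinner x (c *\<^sub>C y) = cnj c * cinner x y"
  by (metis cinner_commute cinner_scaleC_left complex_cnj_mult)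

instantiation complex :: complex_hilbert_space
begin

definition scaleC_complex :: "complex \<Rightarrow> complex \<Rightarrow> complex"
  where "scaleC_complex c x = c * x"

definition cinner_complex :: "complex \<Rightarrow> complex \<Rightarrow> complex"
  where "cinner_complex x y = x * cnj y"

instance
  by standard
    (auto simp: scaleC_complex_def cinner_complex_def inner_complex_def algebra_simps
      scaleR_conv_of_real)

end

text \<open>The algebra of bounded complex-linear operators, with composition as multiplication.\<close>

typedef (overloaded) 'a bop =
  "{T :: 'a::complex_hilbert_space \<Rightarrow>\<^sub>L 'a. \<forall>c x. blinfun_apply T (c *\<^sub>C x) = c *\<^sub>C blinfun_apply T x}"
  morphisms blinfun_of_bop Abs_bop
proof
  show "0 \<in> {T :: 'a \<Rightarrow>\<^sub>L 'a. \<forall>c x. blinfun_apply T (c *\<^sub>C x) = c *\<^sub>C blinfun_apply T x}"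
    using scaleC_add_right[of _ "0::'a" 0] by simp
qed

setup_lifting type_definition_bop

lift_definition bop_apply :: "'a::complex_hilbert_space bop \<Rightarrow> 'a \<Rightarrow> 'a"  (infixr "\<cdot>" 75)
  is blinfun_apply .

lemma bop_eqI: "(\<And>x. S \<cdot> x = T \<cdot> x) \<Longrightarrow> S = T"
  by transfer (rule blinfun_eqI)

lemma bounded_linear_bop_apply: "bounded_linear (\<lambda>x. T \<cdot> x)"
  by transfer (rule blinfun.bounded_linear_right)

lemma bop_apply_scaleC: "T \<cdot> (c *\<^sub>C x) = c *\<^sub>C (T \<cdot> x)"
  by transfer simp

lemma scaleC_zero_right: "c *\<^sub>C (0::'a::complex_inner) = 0"
  using scaleC_add_right[of c "0::'a" 0] by simp

lemma scaleC_minus_right: "c *\<^sub>C (- x) = - (c *\<^sub>C (x::'a::complex_inner))"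
  using scaleC_add_right[of c x "- x"] by (simp add: scaleC_zero_right eq_neg_iff_add_eq_0 add.commute)

lemma scaleC_diff_right: "c *\<^sub>C (x - y) = c *\<^sub>C x - c *\<^sub>C (y::'a::complex_inner)"
  using scaleC_add_right[of c x "- y"] by (simp add: scaleC_minus_right)

instantiation bop :: (complex_hilbert_space) ring
begin

lift_definition zero_bop :: "'a bop" is 0
  by (simp add: scaleC_zero_right)

lift_definition plus_bop :: "'a bop \<Rightarrow> 'a bop \<Rightarrow> 'a bop" is "(+)"
  by (simp add: blinfun.add_left scaleC_add_right)

lift_definition uminus_bop :: "'a bop \<Rightarrow> 'a bop" is uminus
  by (simp add: blinfun.minus_left scaleC_minus_right)

lift_definition minus_bop :: "'a bop \<Rightarrow> 'a bop \<Rightarrow> 'a bop" is "(-)"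
  by (simp add: blinfun.diff_left scaleC_diff_right)

lift_definition times_bop :: "'a bop \<Rightarrow> 'a bop \<Rightarrow> 'a bop" is blinfun_compose
  by simp

instance
  by standard
    (transfer; auto intro!: blinfun_eqI simp: blinfun.add_left blinfun.add_right blinfun.diff_left)+

end

lemma bop_apply_simps [simp]:
  "0 \<cdot> x = 0" "(S + T) \<cdot> x = S \<cdot> x + T \<cdot> x" "(- T) \<cdot> x = - (T \<cdot> x)"
  "(S - T) \<cdot> x = S \<cdot> x - T \<cdot> x" "(S * T) \<cdot> x = S \<cdot> T \<cdot> x"
  by (transfer; simp add: blinfun.add_left blinfun.minus_left blinfun.diff_left)+

definition adj :: "'a::complex_hilbert_space bop \<Rightarrow> 'a bop"
  where "adj T = (THE S. \<forall>x y. cinner (T \<cdot> x) y = cinner x (S \<cdot> y))"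

text \<open>Existence of the adjoint is the Riesz representation theorem; uniqueness is elementary.\<close>

lemma adj_eqI:
  assumes "\<And>x y. cinner (T \<cdot> x) y = cinner x (S \<cdot> y)"
  shows "adj T = S"
  unfolding adj_def
proof (rule the_equality)
  show "\<forall>x y. cinner (T \<cdot> x) y = cinner x (S \<cdot> y)"
    using assms by simp
next
  fix R
  assume R: "\<forall>x y. cinner (T \<cdot> x) y = cinner x (R \<cdot> y)"
  show "R = S"
  proof (rule bop_eqI)
    fix y
    have "inner x (R \<cdot> y) = inner x (S \<cdot> y)" for x
      using R assms by (metis Re_cinner)
    then show "R \<cdot> y = S \<cdot> y"
      by (metis inner_commute vector_eq_ldot)
  qed
qed

definition normal_bop :: "'a::complex_hilbert_space bop \<Rightarrow> bool"
  where "normal_bop T \<longleftrightarrow> T * adj T = adj T * T"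

definition positive_bop :: "'a::complex_hilbert_space bop \<Rightarrow> bool"
  where "positive_bop T \<longleftrightarrow> (\<forall>x. cinner (T \<cdot> x) x \<in> \<real>\<^sub>\<ge>\<^sub>0)"

text \<open>
  The Loewner order. Self-adjointness of the two sides is not part of the relation; on
  self-adjoint operators it is the usual order.
\<close>

instantiation bop :: (complex_hilbert_space) ord
begin

definition less_eq_bop :: "'a bop \<Rightarrow> 'a bop \<Rightarrow> bool"
  where "S \<le> T \<longleftrightarrow> positive_bop (T - S)"

definition less_bop :: "'a bop \<Rightarrow> 'a bop \<Rightarrow> bool"
  where "S < T \<longleftrightarrow> S \<le> T \<and> \<not> T \<le> (S :: 'a bop)"

instance ..

end

definition sqrt_bop :: "'a::complex_hilbert_space bop \<Rightarrow> 'a bop"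
  where "sqrt_bop P = (THE S. positive_bop S \<and> S * S = P)"

definition modulus :: "'a::complex_hilbert_space bop \<Rightarrow> 'a bop"
  where "modulus T = sqrt_bop (adj T * T)"

end

theory Submission
  imports Defs "HOL-Complex_Analysis.Cauchy_Integral_Formula"
begin

text \<open>
  Square roots of operators are monotone: if \<open>S, T\<close> are positive and \<open>\<parallel>S x\<parallel> \<le> \<parallel>T x\<parallel>\<close> for all \<open>x\<close>,
  then \<open>S \<le> T\<close> (\<open>sqrt_monotone\<close>). It therefore suffices to compare \<open>\<parallel>(A + B) x\<parallel>\<close> with
  \<open>\<parallel>(|A| + |B|) x\<parallel>\<close>. Expanding the squares, both contain \<open>\<parallel>A x\<parallel>\<^sup>2 + \<parallel>B x\<parallel>\<^sup>2\<close>. The cross term on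
  the left is \<open>\<langle>(A\<^sup>* B + B\<^sup>* A) x, x\<rangle> \<le> 0\<close> by hypothesis, and the one on the right is
  \<open>2 Re \<langle>|A| |B| x, x\<rangle>\<close>, which is nonnegative as soon as \<open>|A|\<close> and \<open>|B|\<close> commute, because a product
  of commuting positive operators is positive (\<open>positive_bop_mult\<close>).

  Commutation is where normality enters. Fuglede's theorem (\<open>fuglede\<close>) turns \<open>A B = B A\<close> into
  \<open>A\<^sup>* B = B A\<^sup>*\<close>, so \<open>A\<^sup>* A\<close> commutes with \<open>B\<close> and \<open>B\<^sup>*\<close>, hence with \<open>B\<^sup>* B\<close>. A positive square
  root is a norm limit of polynomials in the operator (\<open>positive_sqrt_exists\<close>), so \<open>|A|\<close> and \<open>|B|\<close>
  commute as well.

  None of this uses the spectral theorem. Square roots come from a fixed-point iteration dominated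
  by its scalar counterpart, monotonicity from approximate eigenvectors, and Fuglede's theorem from
  Cauchy's estimate applied to polynomials.
\<close>

section \<open>Bounded operators as a Banach algebra\<close>

instantiation bop :: (complex_hilbert_space) real_normed_vector
begin

lift_definition scaleR_bop :: "real \<Rightarrow> 'a bop \<Rightarrow> 'a bop" is scaleR
  by (simp add: blinfun.scaleR_left scaleC_scaleC mult.commute flip: scaleC_of_real)

lift_definition norm_bop :: "'a bop \<Rightarrow> real" is norm .

definition dist_bop :: "'a bop \<Rightarrow> 'a bop \<Rightarrow> real"
  where "dist_bop S T = norm (S - T)"

definition sgn_bop :: "'a bop \<Rightarrow> 'a bop"
  where "sgn_bop T = scaleR (inverse (norm T)) T"

definition uniformity_bop :: "('a bop \<times> 'a bop) filter"
  where "uniformity_bop = (INF e\<in>{0<..}. principal {(S, T). dist S T < e})"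

definition open_bop :: "'a bop set \<Rightarrow> bool"
  where "open_bop U = (\<forall>S\<in>U. \<forall>\<^sub>F (S', T) in uniformity. S' = S \<longrightarrow> T \<in> U)"

instance
proof
  fix a b :: real and S T :: "'a bop"
  show "a *\<^sub>R (S + T) = a *\<^sub>R S + a *\<^sub>R T"
    by transfer (simp add: scaleR_add_right)
  show "(a + b) *\<^sub>R T = a *\<^sub>R T + b *\<^sub>R T"
    by transfer (simp add: scaleR_add_left)
  show "a *\<^sub>R b *\<^sub>R T = (a * b) *\<^sub>R T"
    by transfer simp
  show "1 *\<^sub>R T = T"
    by transfer simp
  show "dist S T = norm (S - T)"
    by (rule dist_bop_def)
  show "sgn T = inverse (norm T) *\<^sub>R T"
    by (rule sgn_bop_def)
  show "(uniformity :: ('a bop \<times> 'a bop) filter) = (INF e\<in>{0<..}. principal {(S, T). dist S T < e})"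
    by (rule uniformity_bop_def)
  show "open U = (\<forall>S\<in>U. \<forall>\<^sub>F (S', T) in uniformity. S' = S \<longrightarrow> T \<in> U)" for U :: "'a bop set"
    by (rule open_bop_def)
  show "norm T = 0 \<longleftrightarrow> T = 0"
    by transfer simp
  show "norm (S + T) \<le> norm S + norm T"
    by transfer (rule norm_triangle_ineq)
  show "norm (a *\<^sub>R T) = \<bar>a\<bar> * norm T"
    by transfer simp
qed

end

lemma bop_apply_scaleR_left [simp]: "(a *\<^sub>R T) \<cdot> x = a *\<^sub>R (T \<cdot> x)"
  by transfer (simp add: blinfun.scaleR_left)

lemmas bop_apply_linear [simp] =
  bounded_linear.linear[OF bounded_linear_bop_apply, THEN linear_add]
  bounded_linear.linear[OF bounded_linear_bop_apply, THEN linear_diff]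
  bounded_linear.linear[OF bounded_linear_bop_apply, THEN linear_neg]
  bounded_linear.linear[OF bounded_linear_bop_apply, THEN linear_0]
  bounded_linear.linear[OF bounded_linear_bop_apply, THEN linear_scale]

lemma norm_bop_apply: "norm (T \<cdot> x) \<le> norm T * norm x"
  by transfer (rule norm_blinfun)

lemma norm_bop_bound: "0 \<le> b \<Longrightarrow> (\<And>x. norm (T \<cdot> x) \<le> b * norm x) \<Longrightarrow> norm T \<le> b"
  by transfer (rule norm_blinfun_bound)

instance bop :: (complex_hilbert_space) real_normed_algebra
proof
  fix a :: real and S T :: "'a bop"
  show "a *\<^sub>R S * T = a *\<^sub>R (S * T)" "S * a *\<^sub>R T = a *\<^sub>R (S * T)"
    by (rule bop_eqI, simp)+
  show "norm (S * T) \<le> norm S * norm T"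
    by transfer (rule norm_blinfun_compose)
qed

lemma norm_scaleC: "norm (c *\<^sub>C x) = cmod c * norm (x::'a::complex_inner)"
proof -
  have "complex_of_real ((norm (c *\<^sub>C x))\<^sup>2) = c * cnj c * complex_of_real ((norm x)\<^sup>2)"
    by (simp only: cinner_same[symmetric] cinner_scaleC_left cinner_scaleC_right mult_ac)
  also have "\<dots> = complex_of_real ((cmod c * norm x)\<^sup>2)"
    by (simp add: power_mult_distrib flip: complex_norm_square)
  finally show ?thesis
    unfolding of_real_eq_iff by (simp add: power2_eq_iff_nonneg)
qed

instance complex_hilbert_space \<subseteq> banach ..

text \<open>Norm limits of complex-linear operators are complex-linear, so completeness is inherited
  from the space of real-linear bounded operators.\<close>

instance bop :: (complex_hilbert_space) banach
proof
  fix X :: "nat \<Rightarrow> 'a bop"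
  assume X: "Cauchy X"
  have dist_eq: "dist (blinfun_of_bop S) (blinfun_of_bop T) = dist S T" for S T :: "'a bop"
    by (simp add: dist_norm norm_bop.rep_eq minus_bop.rep_eq)
  have "Cauchy (\<lambda>n. blinfun_of_bop (X n))"
    using X unfolding Cauchy_def dist_eq .
  then have "convergent (\<lambda>n. blinfun_of_bop (X n))"
    by (rule Cauchy_convergent)
  then obtain L where L: "(\<lambda>n. blinfun_of_bop (X n)) \<longlonglongrightarrow> L"
    unfolding convergent_def by blast
  have pointwise: "(\<lambda>n. X n \<cdot> x) \<longlonglongrightarrow> blinfun_apply L x" for x
    unfolding bop_apply.rep_eq by (intro tendsto_intros L)
  have scaleC_tendsto: "(\<lambda>n. c *\<^sub>C u n) \<longlonglongrightarrow> c *\<^sub>C l" if "u \<longlonglongrightarrow> l" for c :: complex and u :: "nat \<Rightarrow> 'a" and l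
  proof -
    have "(\<lambda>n. cmod c * norm (u n - l)) \<longlonglongrightarrow> 0"
      using tendsto_mult_right_zero[OF tendsto_norm_zero[OF LIM_zero[OF that]]] .
    then have "(\<lambda>n. norm (c *\<^sub>C u n - c *\<^sub>C l)) \<longlonglongrightarrow> 0"
      by (simp add: norm_scaleC flip: scaleC_diff_right)
    then show ?thesis
      by (rule LIM_zero_cancel[OF tendsto_norm_zero_cancel])
  qed
  have "blinfun_apply L (c *\<^sub>C x) = c *\<^sub>C blinfun_apply L x" for c x
  proof (rule LIMSEQ_unique)
    show "(\<lambda>n. X n \<cdot> (c *\<^sub>C x)) \<longlonglongrightarrow> blinfun_apply L (c *\<^sub>C x)"
      by (rule pointwise)
    show "(\<lambda>n. X n \<cdot> (c *\<^sub>C x)) \<longlonglongrightarrow> c *\<^sub>C blinfun_apply L x"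
      unfolding bop_apply_scaleC by (intro scaleC_tendsto pointwise)
  qed
  then have "L \<in> {T. \<forall>c x. blinfun_apply T (c *\<^sub>C x) = c *\<^sub>C blinfun_apply T x}"
    by blast
  then have "blinfun_of_bop (Abs_bop L) = L"
    by (rule Abs_bop_inverse)
  then have "X \<longlonglongrightarrow> Abs_bop L"
    using L dist_eq[of _ "Abs_bop L"] by (simp add: LIMSEQ_def)
  then show "convergent X"
    by (auto simp: convergent_def)
qed

text \<open>A witness for \<open>bop\<close> from a plain function; homogeneity over the reals is a special case of
  complex homogeneity.\<close>

lemma bop_exI:
  fixes f :: "'a::complex_hilbert_space \<Rightarrow> 'a"
  assumes "\<And>x y. f (x + y) = f x + f y" and hom: "\<And>c x. f (c *\<^sub>C x) = c *\<^sub>C f x"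
    and "\<And>x. norm (f x) \<le> norm x * K"
  shows "\<exists>T. \<forall>x. T \<cdot> x = f x"
proof -
  have "f (r *\<^sub>R x) = r *\<^sub>R f x" for r x
    using hom[of "complex_of_real r" x] by (simp add: scaleC_of_real)
  then have "bounded_linear f"
    using assms by (intro bounded_linear_intro[where K=K]) auto
  then have "blinfun_apply (Blinfun f) = f"
    by (rule bounded_linear_Blinfun_apply)
  then have "Abs_bop (Blinfun f) \<cdot> x = f x" for x
    unfolding bop_apply.rep_eq using hom by (simp add: Abs_bop_inverse)
  then show ?thesis by blast
qed

text \<open>Scalar operators. Complex multiples of \<open>T\<close> are written as products \<open>scal c * T\<close> with a central
  element, so that ring calculations cover them.\<close>

definition scal :: "complex \<Rightarrow> 'a::complex_hilbert_space bop"
  where "scal c = (SOME T. \<forall>x. T \<cdot> x = c *\<^sub>C x)"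

lemma scal_apply [simp]: "scal c \<cdot> x = c *\<^sub>C x"
proof -
  have "\<exists>T :: 'a bop. \<forall>x. T \<cdot> x = c *\<^sub>C x"
    by (rule bop_exI[where K="cmod c"])
      (simp_all add: scaleC_add_right scaleC_scaleC mult.commute norm_scaleC)
  from someI_ex[OF this] show ?thesis
    unfolding scal_def by blast
qed

text \<open>On the zero space the identity operator equals \<open>0\<close>, which rules out the class of unital rings;
  \<open>monoid_mult\<close> does not ask for \<open>0 \<noteq> 1\<close>.\<close>

instantiation bop :: (complex_hilbert_space) monoid_mult
begin

definition one_bop :: "'a bop"
  where "one_bop = scal 1"

instance
proof
  have "1 *\<^sub>C x = x" for x :: 'a
    using scaleC_of_real[of 1 x] by simp
  then show "1 * T = T" "T * 1 = T" for T :: "'a bop"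
    by (auto intro!: bop_eqI simp: one_bop_def)
qed

end

lemma one_bop_apply [simp]: "1 \<cdot> x = x"
  using scaleC_of_real[of 1 x] by (simp add: one_bop_def)

lemma scal_central: "scal c * T = T * scal c"
  by (rule bop_eqI) (simp add: bop_apply_scaleC)

lemma norm_scal_mult: "norm (scal c * T) \<le> cmod c * norm T"
  by (rule norm_bop_bound)
    (simp_all add: norm_scaleC norm_bop_apply mult.assoc mult_left_mono)

lemma bop_apply_tendsto:
  fixes X :: "nat \<Rightarrow> 'a::complex_hilbert_space bop"
  assumes "X \<longlonglongrightarrow> L"
  shows "(\<lambda>n. X n \<cdot> x) \<longlonglongrightarrow> L \<cdot> x"
proof (rule LIM_zero_cancel, rule Lim_null_comparison)
  show "\<forall>\<^sub>F n in sequentially. norm (X n \<cdot> x - L \<cdot> x) \<le> norm (X n - L) * norm x"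
    using norm_bop_apply[of "X n - L" x for n] by simp
  show "(\<lambda>n. norm (X n - L) * norm x) \<longlonglongrightarrow> 0"
    using tendsto_mult_left_zero[OF tendsto_norm_zero[OF LIM_zero[OF assms]]] .
qed

section \<open>Adjoints\<close>

text \<open>Riesz representation. The representing vector minimises \<open>x \<mapsto> \<parallel>x\<parallel>\<^sup>2 - 2 f x\<close>: the
  parallelogram law makes every minimising sequence Cauchy, and the first-order condition at the
  minimum is the claim.\<close>

lemma riesz_representation:
  fixes f :: "'a::{real_inner, complete_space} \<Rightarrow> real"
  assumes "bounded_linear f"
  shows "\<exists>a. \<forall>x. f x = inner a x"
proof -
  interpret f: bounded_linear f by fact
  define q where "q x = inner x x - 2 * f x" for x
  obtain K where K: "\<And>x. norm (f x) \<le> norm x * K"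
    using f.bounded by blast
  \<comment> \<open>\<open>q x \<ge> \<parallel>x\<parallel>\<^sup>2 - 2 K \<parallel>x\<parallel> = (\<parallel>x\<parallel> - K)\<^sup>2 - K\<^sup>2\<close>\<close>
  have below: "- K\<^sup>2 \<le> q x" for x
  proof -
    have "0 \<le> (norm x - K)\<^sup>2" by simp
    then show ?thesis
      using K[of x] by (simp add: q_def power2_eq_square algebra_simps dot_square_norm abs_if split: if_splits)
  qed
  define m where "m = (INF x. q x)"
  have bdd: "bdd_below (range q)"
    using below by (intro bdd_belowI[of _ "- K\<^sup>2"]) auto
  have m_le: "m \<le> q x" for x
    unfolding m_def by (rule cINF_lower[OF bdd]) simp
  have "\<exists>x. q x < m + 1 / real (Suc n)" for n
    using cINF_less_iff[of UNIV q "m + 1 / real (Suc n)"] bdd by (auto simp: m_def)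
  then obtain u where u: "\<And>n. q (u n) < m + 1 / real (Suc n)"
    by metis
  have parallelogram: "(norm (x - y))\<^sup>2 \<le> 2 * (q x + q y - 2 * m)" for x y
  proof -
    define z where "z = (1/2) *\<^sub>R (x + y)"
    have "(norm (x - y))\<^sup>2 = 2 * (q x + q y - 2 * q z)"
      by (simp add: z_def q_def power2_norm_eq_inner inner_diff_left inner_diff_right inner_add_left
          inner_add_right f.add f.scale inner_commute algebra_simps)
    then show ?thesis using m_le[of z] by simp
  qed
  have "Cauchy u"
  proof (rule metric_CauchyI)
    fix e :: real assume "0 < e"
    then obtain N where N: "4 / e\<^sup>2 < real N"
      using reals_Archimedean2 by blast
    have "dist (u i) (u j) < e" if "N \<le> i" "N \<le> j" for i j
    proof -
      have "q (u k) < m + e\<^sup>2 / 4" if "N \<le> k" for k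
      proof -
        have "4 / e\<^sup>2 < real (Suc k)" using N that by linarith
        then have "1 / real (Suc k) < e\<^sup>2 / 4"
          using \<open>0 < e\<close> by (simp add: field_simps)
        then show ?thesis using u[of k] by linarith
      qed
      from this[OF that(1)] this[OF that(2)] have "(norm (u i - u j))\<^sup>2 < e\<^sup>2"
        using parallelogram[of "u i" "u j"] by argo
      then show ?thesis
        using \<open>0 < e\<close> by (simp add: dist_norm power2_less_imp_less)
    qed
    then show "\<exists>N. \<forall>i\<ge>N. \<forall>j\<ge>N. dist (u i) (u j) < e" by blast
  qed
  then have "convergent u"
    by (rule Cauchy_convergent)
  then obtain a where a: "u \<longlonglongrightarrow> a"
    unfolding convergent_def by blast
  have "q a \<le> m + 0"
  proof (rule LIMSEQ_le)
    show "(\<lambda>n. q (u n)) \<longlonglongrightarrow> q a"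
      unfolding q_def by (intro tendsto_intros f.tendsto a)
    show "(\<lambda>n. m + 1 / real (Suc n)) \<longlonglongrightarrow> m + 0"
      by (intro tendsto_intros LIMSEQ_Suc lim_1_over_n)
    show "\<exists>N. \<forall>n\<ge>N. q (u n) \<le> m + 1 / real (Suc n)"
      using u less_imp_le by blast
  qed
  then have a_min: "q a \<le> q x" for x
    using m_le[of x] by linarith
  have "f x = inner a x" for x
  proof (rule ccontr)
    assume ne: "f x \<noteq> inner a x"
    \<comment> \<open>the step of length \<open>d / \<parallel>x\<parallel>\<^sup>2\<close> in direction \<open>x\<close> is the minimum of \<open>q\<close> on the line through \<open>a\<close>\<close>
    define d where "d = f x - inner a x"
    have "x \<noteq> 0" using ne f.zero by auto
    then have pos: "0 < inner x x" by simp
    have "q (a + (d / inner x x) *\<^sub>R x) = q a - d\<^sup>2 / inner x x"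
      using pos by (simp add: q_def d_def f.add f.scale inner_add_left inner_add_right inner_commute[of x a]
          power2_eq_square field_simps)
    moreover have "0 < d\<^sup>2 / inner x x" using pos ne by (simp add: d_def)
    ultimately show False using a_min[of "a + (d / inner x x) *\<^sub>R x"] by linarith
  qed
  then show ?thesis by blast
qed

lemma inner_scaleC: "inner (c *\<^sub>C x) y = inner x (cnj c *\<^sub>C (y::'a::complex_inner))"
  by (simp add: Re_cinner[symmetric] cinner_scaleC_left cinner_scaleC_right)

lemma cinner_inner: "cinner x y = Complex (inner x y) (inner x (\<i> *\<^sub>C (y::'a::complex_inner)))"
  by (rule complex_eqI) (simp_all add: Re_cinner[symmetric] cinner_scaleC_right)

text \<open>The complex form is determined by its real part through \<open>y \<mapsto> \<i> y\<close>, and operators are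
  complex-linear, so adjoints may be recognised on the real inner product.\<close>

lemma adj_eq_real: "(\<And>x y. inner (T \<cdot> x) y = inner x (S \<cdot> y)) \<Longrightarrow> adj T = S"
  by (rule adj_eqI) (simp add: cinner_inner flip: bop_apply_scaleC)

text \<open>Existence of the adjoint: the Riesz vector \<open>s y\<close> of the functional \<open>x \<mapsto> \<langle>T x, y\<rangle>\<close> depends
  linearly and boundedly on \<open>y\<close>, because it is unique.\<close>

lemma inner_adj: "inner (T \<cdot> x) y = inner x (adj T \<cdot> y)"
proof -
  have "\<exists>a. \<forall>x. inner (T \<cdot> x) y = inner a x" for y
    by (rule riesz_representation)
      (rule bounded_linear_compose[OF bounded_linear_inner_left bounded_linear_bop_apply])
  then obtain s where s: "\<And>x y. inner (T \<cdot> x) y = inner x (s y)"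
    by (metis inner_commute)
  have s_eqI: "s y = z" if "\<And>x. inner (T \<cdot> x) y = inner x z" for y z
    using that s by (metis inner_commute vector_eq_ldot)
  have "norm (s y) \<le> norm y * norm T" for y
  proof -
    have "norm (s y) * norm (s y) = inner (T \<cdot> s y) y"
      by (simp add: s flip: power2_norm_eq_inner power2_eq_square)
    also have "\<dots> \<le> norm (T \<cdot> s y) * norm y" by (rule norm_cauchy_schwarz)
    also have "\<dots> \<le> norm T * norm (s y) * norm y"
      by (intro mult_right_mono norm_bop_apply) simp
    finally have "norm (s y) * norm (s y) \<le> norm (s y) * (norm y * norm T)"
      by (simp add: mult_ac)
    then show ?thesis
      by (cases "norm (s y) = 0") (auto dest: mult_left_le_imp_le)
  qed
  moreover have "s (y + z) = s y + s z" for y z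
    by (rule s_eqI) (simp add: inner_add_right s)
  moreover have "s (c *\<^sub>C y) = c *\<^sub>C s y" for c y
  proof (rule s_eqI)
    fix x
    have "inner (T \<cdot> x) (c *\<^sub>C y) = inner (T \<cdot> (cnj c *\<^sub>C x)) y"
      by (simp add: bop_apply_scaleC inner_scaleC)
    then show "inner (T \<cdot> x) (c *\<^sub>C y) = inner x (c *\<^sub>C s y)"
      by (simp add: s inner_scaleC)
  qed
  ultimately obtain S where S: "\<And>y. S \<cdot> y = s y"
    using bop_exI[of s "norm T"] by blast
  then have "adj T = S"
    by (intro adj_eq_real) (simp add: s)
  then show ?thesis by (simp add: S s)
qed

lemma cinner_adj: "cinner (T \<cdot> x) y = cinner x (adj T \<cdot> y)"
  by (simp add: cinner_inner inner_adj flip: bop_apply_scaleC)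

lemma inner_adj': "inner (adj T \<cdot> x) y = inner x (T \<cdot> y)"
  by (metis inner_adj inner_commute)

lemma adj_adj [simp]: "adj (adj T) = T"
  by (rule adj_eq_real) (rule inner_adj')

lemma adj_mult: "adj (S * T) = adj T * adj S"
  by (rule adj_eq_real) (simp add: inner_adj)

lemma adj_add: "adj (S + T) = adj S + adj T"
  by (rule adj_eq_real) (simp add: inner_adj inner_add_left inner_add_right)

lemma norm_adj_le: "norm (adj T) \<le> norm T"
proof (rule norm_bop_bound)
  fix y
  have "norm (adj T \<cdot> y) * norm (adj T \<cdot> y) = inner (T \<cdot> adj T \<cdot> y) y"
    by (simp add: inner_adj flip: power2_norm_eq_inner power2_eq_square)
  also have "\<dots> \<le> norm (T \<cdot> adj T \<cdot> y) * norm y" by (rule norm_cauchy_schwarz)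
  also have "\<dots> \<le> norm T * norm (adj T \<cdot> y) * norm y"
    by (intro mult_right_mono norm_bop_apply) simp
  finally have "norm (adj T \<cdot> y) * norm (adj T \<cdot> y) \<le> norm (adj T \<cdot> y) * (norm T * norm y)"
    by (simp add: mult_ac)
  then show "norm (adj T \<cdot> y) \<le> norm T * norm y"
    by (cases "norm (adj T \<cdot> y) = 0") (auto dest: mult_left_le_imp_le)
qed simp

section \<open>Positive operators and their square roots\<close>

lemma scaleC_i_i: "\<i> *\<^sub>C \<i> *\<^sub>C x = - (x::'a::complex_inner)"
  using scaleC_of_real[of "-1" x] by (simp add: scaleC_scaleC)

lemma inner_i_i: "inner (\<i> *\<^sub>C x) (\<i> *\<^sub>C y) = inner x (y::'a::complex_inner)"
  using scaleC_of_real[of 1 y] by (simp add: inner_scaleC scaleC_scaleC)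

text \<open>Over the complex numbers a real quadratic form forces self-adjointness: the real bilinear
  form \<open>\<langle>T x, \<i> y\<rangle>\<close> vanishes on the diagonal, hence is antisymmetric, and replacing \<open>y\<close> by
  \<open>- \<i> y\<close> turns antisymmetry into symmetry of \<open>\<langle>T x, y\<rangle>\<close>.\<close>

lemma positive_bop_iff: "positive_bop T \<longleftrightarrow> adj T = T \<and> (\<forall>x. 0 \<le> inner (T \<cdot> x) x)"
proof
  assume pos: "positive_bop T"
  have diag: "inner (T \<cdot> x) (\<i> *\<^sub>C x) = 0" for x
    using pos unfolding positive_bop_def complex_nonneg_Reals_iff by (simp add: cinner_inner)
  have antisym: "inner (T \<cdot> x) (\<i> *\<^sub>C y) = - inner (T \<cdot> y) (\<i> *\<^sub>C x)" for x y
    using diag[of "x + y"] diag[of x] diag[of y]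
    by (simp add: scaleC_add_right inner_add_left inner_add_right)
  have "inner (T \<cdot> x) y = inner x (T \<cdot> y)" for x y
  proof -
    have "inner (T \<cdot> x) y = - inner (T \<cdot> x) (\<i> *\<^sub>C \<i> *\<^sub>C y)"
      by (simp add: scaleC_i_i)
    also have "\<dots> = inner (\<i> *\<^sub>C T \<cdot> y) (\<i> *\<^sub>C x)"
      by (simp add: antisym[of x] bop_apply_scaleC)
    also have "\<dots> = inner x (T \<cdot> y)"
      by (simp add: inner_i_i inner_commute)
    finally show ?thesis .
  qed
  then have "adj T = T"
    by (rule adj_eq_real)
  moreover have "0 \<le> inner (T \<cdot> x) x" for x
    using pos unfolding positive_bop_def complex_nonneg_Reals_iff by (simp add: Re_cinner)
  ultimately show "adj T = T \<and> (\<forall>x. 0 \<le> inner (T \<cdot> x) x)" by blast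
next
  assume T: "adj T = T \<and> (\<forall>x. 0 \<le> inner (T \<cdot> x) x)"
  have "Im (cinner (T \<cdot> x) x) = 0" for x
    using cinner_adj[of T x x] cinner_commute[of "T \<cdot> x" x] T
    by (metis Reals_cnj_iff complex_is_Real_iff)
  then show "positive_bop T"
    using T unfolding positive_bop_def complex_nonneg_Reals_iff by (simp add: Re_cinner)
qed

lemma
  shows positive_bop_inner: "positive_bop T \<Longrightarrow> inner (T \<cdot> x) y = inner x (T \<cdot> y)"
    and positive_bop_nonneg: "positive_bop T \<Longrightarrow> 0 \<le> inner (T \<cdot> x) x"
  using inner_adj[of T x y] by (auto simp: positive_bop_iff)

lemma positive_bopI:
  "(\<And>x y. inner (T \<cdot> x) y = inner x (T \<cdot> y)) \<Longrightarrow> (\<And>x. 0 \<le> inner (T \<cdot> x) x) \<Longrightarrow> positive_bop T"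
  by (simp add: positive_bop_iff adj_eq_real)

text \<open>The bound follows from nonnegativity of the quadratic form of \<open>T\<close> at \<open>x - T x / \<parallel>T\<parallel>\<close>.\<close>

lemma positive_bop_norm_le:
  assumes T: "positive_bop T"
  shows "(norm (T \<cdot> x))\<^sup>2 \<le> norm T * inner (T \<cdot> x) x"
proof (cases "norm T = 0")
  case True
  then show ?thesis using norm_bop_apply[of T x] by simp
next
  case False
  define K where "K = norm T"
  have K: "0 < K" using False by (simp add: K_def)
  define y where "y = T \<cdot> x"
  have sym: "inner (T \<cdot> y) x = inner y y"
    by (simp add: positive_bop_inner[OF T] y_def)
  have "0 \<le> inner (T \<cdot> (x - (1 / K) *\<^sub>R y)) (x - (1 / K) *\<^sub>R y)"
    by (rule positive_bop_nonneg[OF T])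
  also have "\<dots> = inner y x - (2 / K) * inner y y + (1 / K) * (1 / K) * inner (T \<cdot> y) y"
    by (simp add: inner_diff_left inner_diff_right sym algebra_simps flip: y_def)
  also have "inner (T \<cdot> y) y \<le> K * inner y y"
  proof -
    have "inner (T \<cdot> y) y \<le> norm (T \<cdot> y) * norm y" by (rule norm_cauchy_schwarz)
    also have "\<dots> \<le> K * norm y * norm y"
      unfolding K_def by (intro mult_right_mono norm_bop_apply) simp
    finally show ?thesis by (simp add: dot_square_norm power2_eq_square mult.assoc)
  qed
  then have "(1 / K) * (1 / K) * inner (T \<cdot> y) y \<le> (1 / K) * (1 / K) * (K * inner y y)"
    using K by (intro mult_left_mono) simp_all
  then have "inner y x - (2 / K) * inner y y + (1 / K) * (1 / K) * inner (T \<cdot> y) y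
      \<le> inner y x - (1 / K) * inner y y"
    using K by (simp add: field_simps)
  finally have "inner y y \<le> K * inner y x"
    using K by (simp add: field_simps)
  then show ?thesis
    by (simp add: y_def K_def power2_norm_eq_inner)
qed

lemma positive_bop_kernel:
  assumes "positive_bop T" "inner (T \<cdot> x) x = 0"
  shows "T \<cdot> x = 0"
  using positive_bop_norm_le[OF assms(1), of x] assms(2) by simp

text \<open>The fixed point \<open>L = (X + L\<^sup>2) / 2\<close> satisfies \<open>(1 - L)\<^sup>2 = 1 - X\<close>. Formally \<open>L\<close> is the power
  series \<open>1 - \<surd>(1 - X)\<close>, and the iterates below are polynomials in \<open>X\<close> whose nonnegative
  coefficients increase to those of the series.\<close>

primrec sqrt_iter :: "'b::real_algebra \<Rightarrow> nat \<Rightarrow> 'b"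
  where
    "sqrt_iter X 0 = 0"
  | "sqrt_iter X (Suc n) = (1/2) *\<^sub>R (X + sqrt_iter X n * sqrt_iter X n)"

lemma sqrt_iter_commute:
  assumes "C * X = X * C"
  shows "C * sqrt_iter X n = sqrt_iter X n * C"
proof (induction n)
  case (Suc n)
  have "C * (sqrt_iter X n * sqrt_iter X n) = sqrt_iter X n * sqrt_iter X n * C"
    using Suc by (metis mult.assoc)
  then show ?case using assms by (simp add: distrib_left distrib_right)
qed simp

text \<open>Because the coefficients are nonnegative, every estimate reduces to the scalar iteration at
  \<open>X = 1\<close>.\<close>

lemma sqrt_iter_norm_le:
  fixes X :: "'b::real_normed_algebra"
  assumes "norm X \<le> 1"
  shows "norm (sqrt_iter X n) \<le> sqrt_iter (1::real) n"
proof (induction n)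
  case (Suc n)
  have "norm (X + sqrt_iter X n * sqrt_iter X n) \<le> norm X + norm (sqrt_iter X n) * norm (sqrt_iter X n)"
    by (meson add_left_mono norm_mult_ineq norm_triangle_ineq order_trans)
  also have "\<dots> \<le> 1 + sqrt_iter (1::real) n * sqrt_iter (1::real) n"
    using assms Suc by (intro add_mono mult_mono) (auto intro: order_trans[OF norm_ge_zero])
  finally show ?case by simp
qed simp

lemma sqrt_iter_step_norm_le:
  fixes X :: "'b::real_normed_algebra"
  assumes "norm X \<le> 1"
  shows "norm (sqrt_iter X (Suc n) - sqrt_iter X n) \<le> sqrt_iter (1::real) (Suc n) - sqrt_iter 1 n"
proof (induction n)
  case 0
  then show ?case using assms by simp
next
  case (Suc n)
  define y z where "y = sqrt_iter X (Suc n)" and "z = sqrt_iter X n"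
  define s t where "s = sqrt_iter (1::real) (Suc n)" and "t = sqrt_iter (1::real) n"
  have le: "norm (y - z) \<le> s - t" "norm y \<le> s" "norm z \<le> t"
    using Suc.IH sqrt_iter_norm_le[OF assms] unfolding y_def z_def s_def t_def by blast+
  have "z * y = y * z"
    unfolding y_def z_def by (intro sqrt_iter_commute sqrt_iter_commute[symmetric]) simp
  moreover have y: "y = (1/2) *\<^sub>R (X + z * z)" and next_y: "sqrt_iter X (Suc (Suc n)) = (1/2) *\<^sub>R (X + y * y)"
    unfolding y_def z_def by (rule sqrt_iter.simps(2))+
  ultimately have "sqrt_iter X (Suc (Suc n)) - y = (1/2) *\<^sub>R ((y - z) * (y + z))"
    unfolding next_y by (subst (3) y) (simp add: algebra_simps)
  moreover have "s = (1/2) *\<^sub>R (1 + t * t)" and next_s: "sqrt_iter (1::real) (Suc (Suc n)) = (1/2) *\<^sub>R (1 + s * s)"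
    unfolding s_def t_def by (rule sqrt_iter.simps(2))+
  then have "sqrt_iter (1::real) (Suc (Suc n)) - s = (1/2) * ((s - t) * (s + t))"
    unfolding next_s by (simp add: field_simps)
  moreover have "norm ((y - z) * (y + z)) \<le> (s - t) * (s + t)"
    using le order_trans[OF norm_ge_zero le(1)]
    by (intro order_trans[OF norm_mult_ineq] mult_mono order_trans[OF norm_triangle_ineq] add_mono)
      simp_all
  ultimately show ?case
    unfolding y_def[symmetric] s_def[symmetric] by simp
qed

lemma sqrt_iter_real_le_1: "sqrt_iter (1::real) n \<le> 1"
proof (induction n)
  case (Suc n)
  have "0 \<le> sqrt_iter (1::real) n"
    using sqrt_iter_norm_le[of "1::real" n] by simp
  then have "sqrt_iter (1::real) n * sqrt_iter 1 n \<le> 1 * 1"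
    using Suc by (intro mult_mono) auto
  then show ?case by simp
qed simp

text \<open>The scalar iteration is increasing and bounded by \<open>1\<close>, hence Cauchy, and it controls the
  increments of the operator iteration. Convergence is therefore in norm, even when
  \<open>\<parallel>X\<parallel> = 1\<close>, and the limit inherits everything that commutes with \<open>X\<close>.\<close>

lemma sqrt_iter_limit:
  fixes X :: "'b::{real_normed_algebra, banach}"
  assumes "norm X \<le> 1"
  obtains L where "sqrt_iter X \<longlonglongrightarrow> L" "norm L \<le> 1" "2 *\<^sub>R L = X + L * L"
    "\<And>C. C * X = X * C \<Longrightarrow> C * L = L * C"
proof -
  let ?s = "sqrt_iter (1::real)"
  have dist_le: "norm (sqrt_iter X (n + k) - sqrt_iter X n) \<le> ?s (n + k) - ?s n" for n k
  proof (induction k)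
    case (Suc k)
    have "sqrt_iter X (n + Suc k) - sqrt_iter X n
        = (sqrt_iter X (Suc (n + k)) - sqrt_iter X (n + k)) + (sqrt_iter X (n + k) - sqrt_iter X n)"
      by simp
    also have "norm \<dots> \<le> (?s (Suc (n + k)) - ?s (n + k)) + (?s (n + k) - ?s n)"
      by (intro order_trans[OF norm_triangle_ineq] add_mono sqrt_iter_step_norm_le assms Suc)
    finally show ?case by simp
  qed simp
  have "incseq ?s"
  proof (rule incseq_SucI)
    fix n
    show "?s n \<le> ?s (Suc n)"
      using order_trans[OF norm_ge_zero sqrt_iter_step_norm_le[OF assms, of n]] by linarith
  qed
  then have "convergent ?s"
    using sqrt_iter_real_le_1 incseq_convergent[of ?s 1] unfolding convergent_def by blast
  then have cauchy: "Cauchy ?s"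
    by (rule convergent_Cauchy)
  have "Cauchy (sqrt_iter X)"
  proof (rule metric_CauchyI)
    fix e :: real assume "0 < e"
    then obtain N where N: "\<And>m n. N \<le> m \<Longrightarrow> N \<le> n \<Longrightarrow> norm (?s m - ?s n) < e"
      using CauchyD[OF cauchy] by metis
    have "dist (sqrt_iter X m) (sqrt_iter X n) < e" if "N \<le> m" "N \<le> n" for m n
      using that
    proof (induction m n rule: linorder_wlog)
      case (le m n)
      then show ?case
        using dist_le[of m "n - m"] N[of n m] by (simp add: dist_norm norm_minus_commute)
    qed (simp add: dist_commute)
    then show "\<exists>N. \<forall>m\<ge>N. \<forall>n\<ge>N. dist (sqrt_iter X m) (sqrt_iter X n) < e" by blast
  qed
  then have "convergent (sqrt_iter X)"
    by (rule Cauchy_convergent)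
  then obtain L where L: "sqrt_iter X \<longlonglongrightarrow> L"
    unfolding convergent_def by blast
  show thesis
  proof (rule that[OF L])
    show "norm L \<le> 1"
    proof (rule LIMSEQ_le_const2)
      show "(\<lambda>n. norm (sqrt_iter X n)) \<longlonglongrightarrow> norm L"
        by (intro tendsto_intros L)
      show "\<exists>N. \<forall>n\<ge>N. norm (sqrt_iter X n) \<le> 1"
        using order_trans[OF sqrt_iter_norm_le[OF assms] sqrt_iter_real_le_1] by blast
    qed
    have "(\<lambda>n. sqrt_iter X (Suc n)) \<longlonglongrightarrow> (1/2) *\<^sub>R (X + L * L)"
      unfolding sqrt_iter.simps by (intro tendsto_intros L)
    then have "L = (1/2) *\<^sub>R (X + L * L)"
      using LIMSEQ_unique LIMSEQ_Suc[OF L] by blast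
    then have "2 *\<^sub>R L = 2 *\<^sub>R (1/2) *\<^sub>R (X + L * L)"
      by (rule arg_cong)
    then show "2 *\<^sub>R L = X + L * L"
      by simp
    show "C * L = L * C" if "C * X = X * C" for C
    proof (rule LIMSEQ_unique)
      show "(\<lambda>n. C * sqrt_iter X n) \<longlonglongrightarrow> C * L"
        by (intro tendsto_intros L)
      show "(\<lambda>n. C * sqrt_iter X n) \<longlonglongrightarrow> L * C"
        unfolding sqrt_iter_commute[OF that] by (intro tendsto_intros L)
    qed
  qed
qed

text \<open>After scaling, \<open>P = \<parallel>P\<parallel> (1 - X)\<close> with \<open>\<parallel>X\<parallel> \<le> 1\<close>, and the root is \<open>\<surd>\<parallel>P\<parallel> (1 - L)\<close> with
  \<open>L\<close> the limit of the iteration; \<open>\<parallel>L\<parallel> \<le> 1\<close> makes it positive.\<close>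

lemma positive_sqrt_exists:
  assumes P: "positive_bop P"
  obtains S where "positive_bop S" "S * S = P" "\<And>C. C * P = P * C \<Longrightarrow> C * S = S * C"
proof (cases "P = 0")
  case True
  show thesis
    by (rule that[of 0]) (simp_all add: True positive_bopI)
next
  case False
  define K where "K = norm P"
  have K: "0 < K" using False by (simp add: K_def)
  define X where "X = 1 - (1 / K) *\<^sub>R P"
  have "norm X \<le> 1"
  proof (rule norm_bop_bound)
    fix x
    define y where "y = P \<cdot> x"
    define a where "a = 1 / K"
    have "X \<cdot> x = x - a *\<^sub>R y"
      by (simp add: X_def y_def a_def)
    then have "(norm (X \<cdot> x))\<^sup>2 = (norm x)\<^sup>2 - 2 * a * inner y x + a * (a * (norm y)\<^sup>2)"
      by (simp add: power2_norm_eq_inner inner_diff_left inner_diff_right inner_commute[of x y]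
          right_diff_distrib)
    also have "a * (a * (norm y)\<^sup>2) \<le> a * inner y x"
      using positive_bop_norm_le[OF P, of x] K
      by (intro mult_left_mono) (simp_all add: K_def[symmetric] y_def a_def field_simps)
    also have "(norm x)\<^sup>2 - 2 * a * inner y x + a * inner y x \<le> (norm x)\<^sup>2"
      using positive_bop_nonneg[OF P, of x] K by (simp add: y_def a_def)
    finally show "norm (X \<cdot> x) \<le> 1 * norm x"
      using power2_le_imp_le[OF _ norm_ge_zero] by simp
  qed simp
  then show thesis
  proof (rule sqrt_iter_limit)
    fix L
    assume L: "sqrt_iter X \<longlonglongrightarrow> L" "norm L \<le> 1" "2 *\<^sub>R L = X + L * L"
      "\<And>C. C * X = X * C \<Longrightarrow> C * L = L * C"
    define S where "S = sqrt K *\<^sub>R (1 - L)"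
    have X_sym: "inner (X \<cdot> x) y = inner x (X \<cdot> y)" for x y
      by (simp add: X_def inner_diff_left inner_diff_right positive_bop_inner[OF P])
    have "inner (sqrt_iter X n \<cdot> x) y = inner x (sqrt_iter X n \<cdot> y)" for n x y
      by (induction n arbitrary: x y) (simp_all add: X_sym inner_add_left inner_add_right)
    then have "(\<lambda>n. inner x (sqrt_iter X n \<cdot> y)) \<longlonglongrightarrow> inner (L \<cdot> x) y" for x y
      using tendsto_inner[OF bop_apply_tendsto[OF L(1)] tendsto_const, of x y] by simp
    then have L_sym: "inner (L \<cdot> x) y = inner x (L \<cdot> y)" for x y
      using tendsto_inner[OF tendsto_const bop_apply_tendsto[OF L(1)], of x y] LIMSEQ_unique by blast
    show thesis
    proof (rule that[of S])
      show "positive_bop S"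
      proof (rule positive_bopI)
        fix x y
        show "inner (S \<cdot> x) y = inner x (S \<cdot> y)"
          by (simp add: S_def inner_diff_left inner_diff_right L_sym)
        have "inner (L \<cdot> x) x \<le> norm (L \<cdot> x) * norm x" by (rule norm_cauchy_schwarz)
        also have "\<dots> \<le> norm L * norm x * norm x" by (intro mult_right_mono norm_bop_apply) simp
        also have "\<dots> \<le> 1 * norm x * norm x" by (intro mult_right_mono L(2)) simp_all
        finally have "inner (L \<cdot> x) x \<le> inner x x"
          by (simp add: dot_square_norm power2_eq_square)
        then show "0 \<le> inner (S \<cdot> x) x"
          using K by (simp add: S_def inner_diff_left)
      qed
      have "S * S = K *\<^sub>R ((1 - L) * (1 - L))"
        using K by (simp add: S_def)
      also have "(1 - L) * (1 - L) = 1 - 2 *\<^sub>R L + L * L"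
        by (simp add: algebra_simps scaleR_2)
      also have "\<dots> = (1 / K) *\<^sub>R P"
        unfolding L(3) by (simp add: X_def)
      finally show "S * S = P"
        using K by simp
      show "C * S = S * C" if "C * P = P * C" for C
        using L(4)[of C] that by (simp add: S_def X_def algebra_simps)
    qed
  qed
qed

text \<open>The root constructed above commutes with every other root \<open>T\<close>. For commuting roots \<open>S, T\<close>
  and \<open>y = (S - T) x\<close>, the sum \<open>\<langle>S y, y\<rangle> + \<langle>T y, y\<rangle>\<close> is zero, so \<open>S y = T y = 0\<close>.\<close>

lemma positive_sqrt_unique:
  assumes "positive_bop S" "positive_bop T" "S * S = T * T" and comm: "S * T = T * S"
  shows "S = T"
proof (rule bop_eqI)
  fix x
  define y where "y = (S - T) \<cdot> x"
  have "S \<cdot> y + T \<cdot> y = (S * S - T * T) \<cdot> x + (T * S - S * T) \<cdot> x"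
    by (simp add: y_def)
  then have "inner (S \<cdot> y) y + inner (T \<cdot> y) y = 0"
    using assms(3) comm by (simp flip: inner_add_left del: bop_apply_simps(5))
  then have "inner (S \<cdot> y) y = 0" "inner (T \<cdot> y) y = 0"
    using positive_bop_nonneg[OF assms(1), of y] positive_bop_nonneg[OF assms(2), of y] by linarith+
  then have "S \<cdot> y = 0" "T \<cdot> y = 0"
    using positive_bop_kernel assms by blast+
  moreover have "inner y y = inner x (S \<cdot> y - T \<cdot> y)"
    using positive_bop_inner[OF assms(1)] positive_bop_inner[OF assms(2)]
    by (simp add: y_def inner_diff_left inner_diff_right)
  ultimately show "S \<cdot> x = T \<cdot> x"
    by (simp add: y_def)
qed

lemma sqrt_bop:
  assumes "positive_bop P"
  shows positive_sqrt_bop: "positive_bop (sqrt_bop P)"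
    and sqrt_bop_square: "sqrt_bop P * sqrt_bop P = P"
    and sqrt_bop_commute: "C * P = P * C \<Longrightarrow> C * sqrt_bop P = sqrt_bop P * C"
proof -
  obtain S where S: "positive_bop S" "S * S = P" "\<And>C. C * P = P * C \<Longrightarrow> C * S = S * C"
    using positive_sqrt_exists[OF assms] by blast
  have "sqrt_bop P = S"
    unfolding sqrt_bop_def
  proof (rule the_equality)
    fix T assume T: "positive_bop T \<and> T * T = P"
    then have "T * P = P * T" by (metis mult.assoc)
    then have "S * T = T * S" using S(3) by metis
    then show "T = S" using positive_sqrt_unique T S by metis
  qed (use S in blast)
  then show "positive_bop (sqrt_bop P)" "sqrt_bop P * sqrt_bop P = P"
    "C * P = P * C \<Longrightarrow> C * sqrt_bop P = sqrt_bop P * C"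
    using S by blast+
qed

text \<open>With \<open>R = \<surd>P\<close> the product is \<open>R Q R\<close>, since \<open>R\<close> commutes with everything that commutes
  with \<open>P\<close>.\<close>

lemma positive_bop_mult:
  assumes P: "positive_bop P" and Q: "positive_bop Q" and comm: "P * Q = Q * P"
  shows "positive_bop (P * Q)"
proof -
  define R where "R = sqrt_bop P"
  have R: "positive_bop R" "R * R = P" "Q * R = R * Q"
    unfolding R_def using comm
    by (simp_all add: positive_sqrt_bop[OF P] sqrt_bop_square[OF P] sqrt_bop_commute[OF P])
  have "P * Q = R * (Q * R)"
    using R(2,3) by (metis mult.assoc)
  then show ?thesis
    using positive_bop_inner[OF R(1)] positive_bop_inner[OF Q] positive_bop_nonneg[OF Q, of "R \<cdot> x" for x]
    by (intro positive_bopI) simp_all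
qed

lemma positive_bop_add: "positive_bop S \<Longrightarrow> positive_bop T \<Longrightarrow> positive_bop (S + T)"
  by (auto simp: positive_bop_iff adj_add inner_add_left intro!: add_nonneg_nonneg)

lemma positive_adj_mult: "positive_bop (adj T * T)"
  using inner_adj'[of T "T \<cdot> x" x for x] by (simp add: positive_bop_iff adj_mult)

lemma modulus:
  shows positive_modulus: "positive_bop (modulus T)"
    and modulus_square: "modulus T * modulus T = adj T * T"
    and modulus_commute: "C * (adj T * T) = adj T * T * C \<Longrightarrow> C * modulus T = modulus T * C"
  unfolding modulus_def using sqrt_bop[OF positive_adj_mult] by blast+

lemma norm_modulus_apply: "norm (modulus T \<cdot> x) = norm (T \<cdot> x)"
proof -
  have "inner (modulus T \<cdot> x) (modulus T \<cdot> x) = inner ((modulus T * modulus T) \<cdot> x) x"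
    by (simp add: positive_bop_inner[OF positive_modulus])
  also have "\<dots> = inner (T \<cdot> x) (T \<cdot> x)"
    unfolding modulus_square by (simp add: inner_adj')
  finally show ?thesis
    by (simp add: norm_eq_sqrt_inner)
qed

text \<open>Suppose the quadratic form of \<open>S - T\<close> has a supremum \<open>\<mu> > 0\<close> on the unit sphere,
  and take a unit vector \<open>x\<close> at which it is almost attained. By the norm bound for the
  positive operator \<open>\<mu> - (S - T)\<close>,
  the vector \<open>S x\<close> is then close to \<open>T x + \<mu> x\<close>. But \<open>\<parallel>T x + \<mu> x\<parallel>\<^sup>2 \<ge> \<parallel>T x\<parallel>\<^sup>2 + \<mu>\<^sup>2\<close>, which contradicts
  \<open>\<parallel>S x\<parallel> \<le> \<parallel>T x\<parallel>\<close>.\<close>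

lemma sqrt_monotone:
  assumes S: "positive_bop S" and T: "positive_bop T"
    and le: "\<And>x. norm (S \<cdot> x) \<le> norm (T \<cdot> x)"
  shows "S \<le> T"
proof -
  define q where "q x = inner ((S - T) \<cdot> x) x" for x
  have sym: "inner ((S - T) \<cdot> x) y = inner x ((S - T) \<cdot> y)" for x y
    by (simp add: inner_diff_left inner_diff_right positive_bop_inner[OF S] positive_bop_inner[OF T])
  have "q x0 \<le> 0" for x0
  proof (rule ccontr)
    assume "\<not> q x0 \<le> 0"
    then have "x0 \<noteq> 0" by (auto simp: q_def)
    define \<mu> where "\<mu> = (SUP x\<in>sphere 0 1. q x)"
    have q_scaleR: "q (c *\<^sub>R x) = c\<^sup>2 * q x" for c x
      by (simp add: q_def power2_eq_square right_diff_distrib flip: scaleR_diff_right)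
    have scale: "q x = (norm x)\<^sup>2 * q (sgn x)" for x
      using q_scaleR[of "norm x" "sgn x"] by (cases "x = 0") (simp_all add: sgn_div_norm)
    have bdd: "bdd_above (q ` sphere 0 1)"
    proof (rule bdd_aboveI2)
      fix x :: 'a assume "x \<in> sphere 0 1"
      then show "q x \<le> norm (S - T)"
        using norm_cauchy_schwarz[of "(S - T) \<cdot> x" x] norm_bop_apply[of "S - T" x] by (simp add: q_def)
    qed
    have sgn_sphere: "sgn x \<in> sphere 0 1" if "x \<noteq> 0" for x :: 'a
      using that by (simp add: norm_sgn)
    have q_le: "q x \<le> \<mu> * (norm x)\<^sup>2" for x
    proof (cases "x = 0")
      case False
      then have "q (sgn x) \<le> \<mu>"
        unfolding \<mu>_def by (intro cSUP_upper sgn_sphere bdd)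
      then show ?thesis
        by (subst scale) (simp add: mult.commute mult_right_mono)
    qed (simp add: q_def)
    have "0 < \<mu> * (norm x0)\<^sup>2"
      using q_le[of x0] \<open>\<not> q x0 \<le> 0\<close> by linarith
    then have \<mu>: "0 < \<mu>"
      by (simp add: zero_less_mult_iff)
    define C where "C = \<mu> *\<^sub>R 1 - (S - T)"
    have C: "positive_bop C"
    proof (rule positive_bopI)
      fix x y
      show "inner (C \<cdot> x) y = inner x (C \<cdot> y)"
        using sym by (simp add: C_def inner_diff_left inner_diff_right)
      show "0 \<le> inner (C \<cdot> x) x"
        using q_le[of x] by (simp add: C_def q_def inner_diff_left power2_norm_eq_inner)
    qed
    \<comment> \<open>\<open>\<epsilon>\<close> is small enough for \<open>\<epsilon> (2 \<parallel>T\<parallel> + \<epsilon>) < \<mu>\<^sup>2\<close>, and \<open>\<delta>\<close> for \<open>\<parallel>C x\<parallel> \<le> \<epsilon>\<close> at a unit vector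
      where the form of \<open>S - T\<close> exceeds \<open>\<mu> - \<delta>\<close>\<close>
    define \<epsilon> where "\<epsilon> = min 1 (\<mu>\<^sup>2 / (2 * norm T + 2))"
    have \<epsilon>: "0 < \<epsilon>" "\<epsilon> \<le> 1" "\<epsilon> * (2 * norm T + 2) \<le> \<mu>\<^sup>2"
    proof -
      have pos: "0 < 2 * norm T + 2" by (simp add: add_nonneg_pos)
      then show "0 < \<epsilon>" using \<mu> by (simp add: \<epsilon>_def)
      show "\<epsilon> \<le> 1" by (simp add: \<epsilon>_def)
      have "\<epsilon> \<le> \<mu>\<^sup>2 / (2 * norm T + 2)" by (simp add: \<epsilon>_def)
      then show "\<epsilon> * (2 * norm T + 2) \<le> \<mu>\<^sup>2" using pos by (simp add: pos_le_divide_eq)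
    qed
    define \<delta> where "\<delta> = \<epsilon>\<^sup>2 / (norm C + 1)"
    have \<delta>: "0 < \<delta>" "norm C * \<delta> \<le> \<epsilon>\<^sup>2"
    proof -
      have pos: "0 < norm C + 1" by (simp add: add_nonneg_pos)
      then show "0 < \<delta>" using \<epsilon>(1) by (simp add: \<delta>_def)
      have "norm C * \<epsilon>\<^sup>2 \<le> \<epsilon>\<^sup>2 * (norm C + 1)" by (simp add: algebra_simps)
      then show "norm C * \<delta> \<le> \<epsilon>\<^sup>2" using pos by (simp add: \<delta>_def pos_divide_le_eq)
    qed
    have "\<exists>x\<in>sphere 0 1. \<mu> - \<delta> < q x"
      using less_cSUP_iff[of "sphere 0 1" q "\<mu> - \<delta>"] bdd sgn_sphere[OF \<open>x0 \<noteq> 0\<close>] \<delta>(1)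
      unfolding \<mu>_def[symmetric] by force
    then obtain x where x: "norm x = 1" "\<mu> - \<delta> < q x"
      by auto
    have "(norm (C \<cdot> x))\<^sup>2 \<le> norm C * inner (C \<cdot> x) x"
      by (rule positive_bop_norm_le[OF C])
    also have "inner (C \<cdot> x) x = \<mu> - q x"
      using x(1) by (simp add: C_def q_def inner_diff_left dot_square_norm)
    also have "norm C * (\<mu> - q x) \<le> norm C * \<delta>"
      using x(2) by (intro mult_left_mono) simp_all
    also note \<delta>(2)
    finally have Cx: "norm (C \<cdot> x) \<le> \<epsilon>"
      by (rule power2_le_imp_le) (use \<epsilon>(1) in simp)
    have Tx: "norm (T \<cdot> x) \<le> norm T"
      using norm_bop_apply[of T x] x(1) by simp
    define y where "y = T \<cdot> x"
    have "y + \<mu> *\<^sub>R x = S \<cdot> x + C \<cdot> x"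
      by (simp add: C_def y_def)
    then have "norm (y + \<mu> *\<^sub>R x) \<le> norm y + \<epsilon>"
      using norm_triangle_ineq[of "S \<cdot> x" "C \<cdot> x"] le[of x] Cx by (simp add: y_def)
    then have "(norm (y + \<mu> *\<^sub>R x))\<^sup>2 \<le> (norm y + \<epsilon>)\<^sup>2"
      by (rule power_mono) simp
    moreover have "(norm (y + \<mu> *\<^sub>R x))\<^sup>2 = (norm y)\<^sup>2 + 2 * \<mu> * inner y x + \<mu>\<^sup>2 * inner x x"
      unfolding power2_norm_eq_inner
      by (simp add: inner_add_left inner_add_right inner_commute[of x y] power2_eq_square distrib_left)
    moreover have "inner x x = 1"
      using x(1) by (simp add: dot_square_norm)
    moreover have "0 \<le> 2 * \<mu> * inner y x"
      using \<mu> positive_bop_nonneg[OF T, of x] by (simp add: y_def)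
    moreover have "(norm y + \<epsilon>)\<^sup>2 = (norm y)\<^sup>2 + \<epsilon> * (2 * norm y + \<epsilon>)"
      by (simp add: power2_eq_square algebra_simps)
    ultimately have "\<mu>\<^sup>2 \<le> \<epsilon> * (2 * norm y + \<epsilon>)"
      by simp
    also have "\<dots> < \<epsilon> * (2 * norm T + 2)"
      using \<epsilon>(1,2) Tx by (intro mult_strict_left_mono) (simp_all add: y_def)
    finally show False
      using \<epsilon>(3) by linarith
  qed
  moreover have "inner ((T - S) \<cdot> x) x = - q x" for x
    by (simp add: q_def inner_diff_left)
  ultimately show ?thesis
    unfolding less_eq_bop_def
    by (intro positive_bopI)
      (simp_all add: inner_diff_left inner_diff_right positive_bop_inner[OF S] positive_bop_inner[OF T])
qed

section \<open>Fuglede's theorem\<close>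

lemma norm_cinner_le: "cmod (cinner x y) \<le> norm x * norm y"
proof (cases "cinner x y = 0")
  case False
  \<comment> \<open>rotating \<open>x\<close> by the phase \<open>c\<close> makes the form real, where the real inequality applies\<close>
  define c where "c = cnj (sgn (cinner x y))"
  have c: "c * cinner x y = complex_of_real (cmod (cinner x y))"
    using False complex_norm_square[of "cinner x y"]
    by (simp add: c_def sgn_div_norm scaleR_conv_of_real power2_eq_square field_simps)
  have c_norm: "cmod c = 1"
    using False by (simp add: c_def norm_sgn)
  have "cmod (cinner x y) = inner (c *\<^sub>C x) y"
    using c by (simp add: Re_cinner[symmetric] cinner_scaleC_left)
  also have "\<dots> \<le> norm (c *\<^sub>C x) * norm y"
    by (rule norm_cauchy_schwarz)
  finally show ?thesis
    by (simp add: norm_scaleC c_norm)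
qed simp

text \<open>Let \<open>A\<close> be normal, \<open>A B = B A\<close> and \<open>D Y = A\<^sup>* Y - Y A\<^sup>*\<close>. The
  classical argument applies Liouville's theorem to the entire
  function \<open>h \<mapsto> exp(h D) B = exp(h A\<^sup>*) B exp(- h A\<^sup>*)\<close>, which equals
  \<open>exp(W) B exp(- W)\<close> for the skew-adjoint \<open>W = h A\<^sup>* - cnj h A\<close> and is thus bounded by \<open>\<parallel>B\<parallel>\<close>.
  Replacing the exponential by the Euler steps \<open>(1 + h D)\<^sup>n\<close> leaves polynomials in \<open>h\<close>, to which
  Cauchy's estimate for the first derivative applies; the following is one such step.\<close>

definition ad_step :: "'a::complex_hilbert_space bop \<Rightarrow> complex \<Rightarrow> 'a bop \<Rightarrow> 'a bop"
  where "ad_step A h Y = Y + scal h * (adj A * Y - Y * adj A)"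

text \<open>For skew \<open>W\<close> the vectors \<open>x\<close> and \<open>W x\<close> are orthogonal over the reals, so \<open>1 + W\<close> is an isometry
  up to second order. This is the infinitesimal form of \<open>exp(W)\<close> being unitary.\<close>

lemma skew_one_plus_norm:
  assumes skew: "\<And>x. inner (W \<cdot> x) x = 0" and w: "norm W \<le> w"
  shows "norm (1 + W) \<le> sqrt (1 + w\<^sup>2)"
proof (rule norm_bop_bound)
  fix x
  have "norm (W \<cdot> x) \<le> w * norm x"
    using norm_bop_apply[of W x] w mult_right_mono[of "norm W" w "norm x"] by simp
  then have "(norm (W \<cdot> x))\<^sup>2 \<le> (w * norm x)\<^sup>2"
    by (rule power_mono) simp
  moreover have "(norm ((1 + W) \<cdot> x))\<^sup>2 = (norm x)\<^sup>2 + (norm (W \<cdot> x))\<^sup>2"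
    using skew[of x] by (simp add: power2_norm_eq_inner inner_add_left inner_add_right inner_commute[of x "W \<cdot> x"])
  ultimately have "(norm ((1 + W) \<cdot> x))\<^sup>2 \<le> (1 + w\<^sup>2) * (norm x)\<^sup>2"
    by (simp add: power_mult_distrib distrib_right)
  then have "sqrt ((norm ((1 + W) \<cdot> x))\<^sup>2) \<le> sqrt ((1 + w\<^sup>2) * (norm x)\<^sup>2)"
    by (rule real_sqrt_le_mono)
  then show "norm ((1 + W) \<cdot> x) \<le> sqrt (1 + w\<^sup>2) * norm x"
    by (simp add: real_sqrt_mult)
qed simp

text \<open>Since \<open>Y\<close> commutes with \<open>A\<close>, subtracting a multiple of \<open>A\<close> from \<open>h A\<^sup>*\<close> does not change the
  commutator: \<open>h D Y = W Y - Y W\<close> with \<open>W = h A\<^sup>* - cnj h A\<close> skew. Hence the step is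
  \<open>(1 + W) Y (1 - W) + W Y W\<close> and enlarges the norm only to second order in \<open>h\<close>.\<close>

lemma norm_ad_step_le:
  assumes comm: "A * Y = Y * A"
  shows "norm (ad_step A h Y) \<le> (1 + 8 * (cmod h)\<^sup>2 * (norm A)\<^sup>2) * norm Y"
proof -
  define W where "W = scal h * adj A - scal (cnj h) * A"
  define w where "w = 2 * cmod h * norm A"
  have "norm W \<le> norm (scal h * adj A) + norm (scal (cnj h) * A)"
    unfolding W_def by (rule norm_triangle_ineq4)
  also have "\<dots> \<le> cmod h * norm A + cmod h * norm A"
    using norm_scal_mult[of "cnj h" A]
    by (intro add_mono order_trans[OF norm_scal_mult] mult_left_mono norm_adj_le) simp_all
  finally have w: "norm W \<le> w"
    by (simp add: w_def mult_ac)
  have skew: "inner (W \<cdot> x) x = 0" for x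
  proof -
    have "inner (h *\<^sub>C adj A \<cdot> x) x = inner x (A \<cdot> cnj h *\<^sub>C x)"
      by (simp add: inner_scaleC inner_adj')
    also have "\<dots> = inner (cnj h *\<^sub>C A \<cdot> x) x"
      by (simp add: bop_apply_scaleC inner_commute)
    finally show ?thesis
      by (simp add: W_def inner_diff_left)
  qed
  have plus: "norm (1 + W) \<le> sqrt (1 + w\<^sup>2)"
    by (rule skew_one_plus_norm[OF skew w])
  have minus: "norm (1 - W) \<le> sqrt (1 + w\<^sup>2)"
    using skew_one_plus_norm[of "- W" w] skew w by simp
  have "scal (cnj h) * A * Y = Y * (scal (cnj h) * A)"
    using comm scal_central[of "cnj h"] by (metis mult.assoc)
  moreover have "scal h * (Y * adj A) = Y * (scal h * adj A)"
    using scal_central[of h Y] by (metis mult.assoc)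
  ultimately have "scal h * (adj A * Y - Y * adj A) = W * Y - Y * W"
    by (simp add: W_def algebra_simps)
  then have "ad_step A h Y = (1 + W) * Y * (1 - W) + W * Y * W"
    by (simp add: ad_step_def algebra_simps)
  also have "norm \<dots> \<le> norm (1 + W) * norm Y * norm (1 - W) + norm W * norm Y * norm W"
    by (intro order_trans[OF norm_triangle_ineq] add_mono order_trans[OF norm_mult_ineq] mult_right_mono
        norm_mult_ineq norm_ge_zero)
  also have "\<dots> \<le> sqrt (1 + w\<^sup>2) * norm Y * sqrt (1 + w\<^sup>2) + w * norm Y * w"
    using w order_trans[OF norm_ge_zero w] by (intro add_mono mult_mono plus minus) simp_all
  also have "\<dots> = (1 + 2 * w\<^sup>2) * norm Y"
    by (simp add: power2_eq_square algebra_simps flip: real_sqrt_mult)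
  also have "2 * w\<^sup>2 = 8 * (cmod h)\<^sup>2 * (norm A)\<^sup>2"
    by (simp add: w_def power_mult_distrib)
  finally show ?thesis .
qed

lemma ad_step_commute:
  assumes "normal_bop A" "A * Y = Y * A"
  shows "A * ad_step A h Y = ad_step A h Y * A"
proof -
  have "A * (adj A * Y) = adj A * Y * A" "A * (Y * adj A) = Y * adj A * A"
    using assms unfolding normal_bop_def by (metis mult.assoc)+
  moreover have "A * (scal h * Z) = scal h * (A * Z)" for Z
    using scal_central[of h A] by (metis mult.assoc)
  ultimately show ?thesis
    using assms(2) by (simp add: ad_step_def algebra_simps)
qed

text \<open>Normality of \<open>A\<close> keeps all iterates in the commutant of \<open>A\<close>, where the norm estimate for a
  step applies.\<close>

lemma ad_iterate:
  assumes "normal_bop A" "A * B = B * A"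
  shows "A * (ad_step A h ^^ n) B = (ad_step A h ^^ n) B * A"
    and "norm ((ad_step A h ^^ n) B) \<le> (1 + 8 * (cmod h)\<^sup>2 * (norm A)\<^sup>2) ^ n * norm B"
proof (induction n)
  case (Suc n)
  show comm: "A * (ad_step A h ^^ Suc n) B = (ad_step A h ^^ Suc n) B * A"
    using ad_step_commute[OF assms(1) Suc(1)] by simp
  have "norm ((ad_step A h ^^ Suc n) B) \<le> (1 + 8 * (cmod h)\<^sup>2 * (norm A)\<^sup>2) * norm ((ad_step A h ^^ n) B)"
    using norm_ad_step_le[OF Suc(1)] by simp
  also have "\<dots> \<le> (1 + 8 * (cmod h)\<^sup>2 * (norm A)\<^sup>2) * ((1 + 8 * (cmod h)\<^sup>2 * (norm A)\<^sup>2) ^ n * norm B)"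
    by (intro mult_left_mono Suc(2)) simp
  finally show "norm ((ad_step A h ^^ Suc n) B) \<le> (1 + 8 * (cmod h)\<^sup>2 * (norm A)\<^sup>2) ^ Suc n * norm B"
    by (simp add: mult.assoc)
qed (use assms in simp_all)

lemma cinner_adj': "cinner (adj T \<cdot> x) y = cinner x (T \<cdot> y)"
  using cinner_adj[of "adj T"] by simp

text \<open>The matrix entries are polynomials in \<open>h\<close> whose linear coefficient is \<open>n \<langle>D B x, y\<rangle>\<close>.
  The induction needs all \<open>x, y\<close> at once, because a step moves \<open>A\<^sup>*\<close> onto \<open>x\<close> and \<open>A\<close> onto
  \<open>y\<close>.\<close>

lemma ad_iterate_matrix_entry:
  fixes A B :: "'a::complex_hilbert_space bop"
  defines "p \<equiv> \<lambda>n x y h. cinner ((ad_step A h ^^ n) B \<cdot> x) y"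
  shows "p n x y holomorphic_on UNIV"
    and "(p n x y has_field_derivative of_nat n * cinner ((adj A * B - B * adj A) \<cdot> x) y) (at 0)"
proof -
  have zero: "p 0 x y = (\<lambda>h. cinner (B \<cdot> x) y)" for x y
    by (simp add: p_def)
  have minus: "cinner (u - v) z = cinner u z - cinner v z" for u v z :: 'a
    using cinner_add_left[of "u - v" v z] by simp
  have suc: "p (Suc n) x y = (\<lambda>h. p n x y h + h * (p n x (A \<cdot> y) h - p n (adj A \<cdot> x) y h))" for n x y
    by (simp add: p_def ad_step_def fun_eq_iff cinner_add_left cinner_scaleC_left minus cinner_adj'
        right_diff_distrib)
  have at_0: "p n x y 0 = cinner (B \<cdot> x) y" for n x y
    by (induction n arbitrary: x y) (simp_all add: zero suc)
  show holo: "p n x y holomorphic_on UNIV"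
    by (induction n arbitrary: x y) (auto simp: zero suc intro!: holomorphic_intros)
  show "(p n x y has_field_derivative of_nat n * cinner ((adj A * B - B * adj A) \<cdot> x) y) (at 0)"
  proof (induction n arbitrary: x y)
    case 0
    show ?case by (simp add: zero)
  next
    case (Suc n)
    show ?case
      unfolding suc
      by (rule derivative_eq_intros Suc refl)+
        (simp add: at_0 minus cinner_adj' algebra_simps)
  qed
qed

text \<open>Take \<open>n = m\<^sup>2\<close> steps on the circle \<open>\<bar>h\<bar> = 1 / m\<close>. The total growth
  \<open>(1 + 8 \<parallel>A\<parallel>\<^sup>2 / m\<^sup>2)\<^sup>n\<close> stays below \<open>exp(8 \<parallel>A\<parallel>\<^sup>2)\<close>, whereas Cauchy's estimate bounds the
  derivative \<open>m\<^sup>2 \<langle>D B x, y\<rangle>\<close> by \<open>m\<close> times a constant. Letting \<open>m\<close> grow forces \<open>D B = 0\<close>.\<close>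

theorem fuglede:
  fixes A B :: "'a::complex_hilbert_space bop"
  assumes "normal_bop A" "A * B = B * A"
  shows "adj A * B = B * adj A"
proof -
  define X where "X = adj A * B - B * adj A"
  have "cinner (X \<cdot> x) y = 0" for x y
  proof (rule ccontr)
    assume ne: "cinner (X \<cdot> x) y \<noteq> 0"
    define K where "K = exp (8 * (norm A)\<^sup>2) * norm B * norm x * norm y"
    have "real m * cmod (cinner (X \<cdot> x) y) \<le> K" if "0 < m" for m :: nat
    proof -
      define n where "n = m\<^sup>2"
      define p where "p = (\<lambda>h. cinner ((ad_step A h ^^ n) B \<cdot> x) y)"
      have m: "0 < real m" using that by simp
      have "cmod ((deriv ^^ 1) p 0) \<le> fact 1 * K / (1 / real m) ^ 1"
      proof (rule Cauchy_inequality)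
        have holo: "p holomorphic_on UNIV"
          unfolding p_def by (rule ad_iterate_matrix_entry(1))
        then show "p holomorphic_on ball 0 (1 / real m)"
          by (rule holomorphic_on_subset) simp
        show "continuous_on (cball 0 (1 / real m)) p"
          using holo holomorphic_on_imp_continuous_on holomorphic_on_subset by blast
        show "0 < 1 / real m" using m by simp
        fix h :: complex assume "cmod (0 - h) = 1 / real m"
        then have h: "(cmod h)\<^sup>2 = 1 / real n"
          by (simp add: n_def power_divide)
        have "(1 + 8 * (cmod h)\<^sup>2 * (norm A)\<^sup>2) ^ n \<le> exp (8 * (cmod h)\<^sup>2 * (norm A)\<^sup>2) ^ n"
          by (intro power_mono exp_ge_add_one_self) simp
        also have "\<dots> = exp (real n * (8 * (cmod h)\<^sup>2 * (norm A)\<^sup>2))"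
          by (rule exp_of_nat_mult[symmetric])
        also have "real n * (8 * (cmod h)\<^sup>2 * (norm A)\<^sup>2) = 8 * (norm A)\<^sup>2"
          using that by (simp add: h n_def)
        finally have growth: "(1 + 8 * (cmod h)\<^sup>2 * (norm A)\<^sup>2) ^ n \<le> exp (8 * (norm A)\<^sup>2)" .
        have "cmod (p h) \<le> norm ((ad_step A h ^^ n) B \<cdot> x) * norm y"
          unfolding p_def by (rule norm_cinner_le)
        also have "\<dots> \<le> norm ((ad_step A h ^^ n) B) * norm x * norm y"
          by (intro mult_right_mono norm_bop_apply) simp
        also have "\<dots> \<le> exp (8 * (norm A)\<^sup>2) * norm B * norm x * norm y"
          by (intro mult_right_mono order_trans[OF ad_iterate(2)[OF assms]] growth) simp_all
        finally show "cmod (p h) \<le> K"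
          by (simp add: K_def)
      qed
      moreover have "deriv p 0 = of_nat n * cinner (X \<cdot> x) y"
        unfolding p_def X_def by (intro DERIV_imp_deriv ad_iterate_matrix_entry(2))
      ultimately have "real m * real m * cmod (cinner (X \<cdot> x) y) \<le> K * real m"
        by (simp add: n_def norm_mult power2_eq_square)
      then show ?thesis
        using m by (simp add: mult_ac)
    qed
    moreover obtain m :: nat where "K / cmod (cinner (X \<cdot> x) y) < real m"
      using reals_Archimedean2 by blast
    moreover have "0 \<le> K" by (simp add: K_def)
    ultimately show False
      using ne by (metis divide_nonneg_pos divide_less_eq not_less of_nat_0_less_iff order_le_less_trans zero_less_norm_iff)
  qed
  then have "X \<cdot> x = 0" for x
    using cinner_same[of "X \<cdot> x"] by simp
  then have "X = 0"
    by (intro bop_eqI) simp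
  then show ?thesis by (simp add: X_def)
qed

section \<open>The triangle inequality for moduli\<close>

theorem theorem3p15:
  fixes A B :: "'a::complex_hilbert_space bop"
  assumes "A * B = B * A"
    and "normal_bop A"
    and "adj A * B + adj B * A \<le> 0"
  shows "modulus (A + B) \<le> modulus A + modulus B"
proof -
  let ?P = "adj A * A"
  \<comment> \<open>\<open>|A|\<^sup>2\<close> commutes with \<open>B\<close> and, taking adjoints, with \<open>B\<^sup>*\<close>; roots inherit commutation\<close>
  have "adj A * B = B * adj A"
    by (rule fuglede) fact+
  then have PB: "?P * B = B * ?P"
    using assms(1) by (metis mult.assoc)
  then have "adj (?P * B) = adj (B * ?P)"
    by (rule arg_cong)
  then have "adj B * ?P = ?P * adj B"
    by (simp add: adj_mult)
  with PB have "adj B * B * ?P = ?P * (adj B * B)"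
    by (metis mult.assoc)
  then have "adj B * B * modulus A = modulus A * (adj B * B)"
    by (rule modulus_commute)
  then have comm: "modulus A * modulus B = modulus B * modulus A"
    by (intro modulus_commute) simp
  have cross: "inner (A \<cdot> x) (B \<cdot> x) \<le> 0" for x
  proof -
    have "0 \<le> inner ((0 - (adj A * B + adj B * A)) \<cdot> x) x"
      using assms(3) unfolding less_eq_bop_def by (rule positive_bop_nonneg)
    then show ?thesis
      by (simp add: inner_diff_left inner_adj' inner_commute[of "B \<cdot> x" "A \<cdot> x"])
  qed
  show ?thesis
  proof (rule sqrt_monotone)
    show "positive_bop (modulus (A + B))" "positive_bop (modulus A + modulus B)"
      by (intro positive_bop_add positive_modulus)+
    fix x
    have "(norm (A \<cdot> x + B \<cdot> x))\<^sup>2 = (norm (A \<cdot> x))\<^sup>2 + (norm (B \<cdot> x))\<^sup>2 + 2 * inner (A \<cdot> x) (B \<cdot> x)"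
      by (simp add: power2_norm_eq_inner inner_add_left inner_add_right inner_commute[of "B \<cdot> x" "A \<cdot> x"])
    also have "\<dots> \<le> (norm (A \<cdot> x))\<^sup>2 + (norm (B \<cdot> x))\<^sup>2 + 2 * inner (modulus A \<cdot> x) (modulus B \<cdot> x)"
    proof -
      have "0 \<le> inner ((modulus A * modulus B) \<cdot> x) x"
        by (intro positive_bop_nonneg positive_bop_mult positive_modulus comm)
      then have "0 \<le> inner (modulus A \<cdot> x) (modulus B \<cdot> x)"
        using positive_bop_inner[OF positive_modulus, of A "modulus B \<cdot> x" x]
        by (simp add: inner_commute)
      then show ?thesis using cross[of x] by simp
    qed
    also have "\<dots> = (norm (modulus A \<cdot> x + modulus B \<cdot> x))\<^sup>2"
      unfolding norm_modulus_apply[of A, symmetric] norm_modulus_apply[of B, symmetric]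
      by (simp add: power2_norm_eq_inner inner_add_left inner_add_right inner_commute[of "modulus B \<cdot> x" "modulus A \<cdot> x"])
    finally have "norm (A \<cdot> x + B \<cdot> x) \<le> norm (modulus A \<cdot> x + modulus B \<cdot> x)"
      by (rule power2_le_imp_le) simp
    then show "norm (modulus (A + B) \<cdot> x) \<le> norm ((modulus A + modulus B) \<cdot> x)"
      by (simp add: norm_modulus_apply)
  qed
qed

end
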